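(* For every command $C$ and all $P,Q\subseteq\Sigma$, interpreted in the Boolean semiring: $\vDash\langle P\rangle\,C\,\langle\boxdot Q\rangle$ holds iff $P\subseteq[C]^\star Q$, iff the total-correctness Hoare triple $[P]\,C\,[Q]$ is valid.
   Context: Work in the Boolean semiring $\langle\{0,1\},\lor,\land,0,1\rangle$ (top element $\top=1$). Let $\Sigma$ be a set of program states and $\natural\notin\Sigma$ a distinguished element representing nontermination, $\Sigma_\natural=\Sigma\cup\{\natural\}$. Weighting functions $m:\Sigma_\natural\to\{0,1\}$ are identified with subsets of $\Sigma_\natural$ (their supports); the mass $|m|$ is $1$ iff the support is nonempty. The command $C$ has denotation $\llbracket C\rrbracket:\Sigma\to\mathcal P(\Sigma_\natural)$ (the set of possible outcomes, $\natural$ meaning possible divergence), lifted by $\llbracket C\rrbracket^\dagger(S)=\bigcup_{\sigma\in S\cap\Sigma}\llbracket C\rrbracket(\sigma)\cup(S\cap\{\natural\})$. As a precondition, $P\subseteq\Sigma$ denotes $P^{(1)}=\{m\mid|m|=1,\ \mathrm{supp}(m)\subseteq P\}$. The termination-sensitive box is $\boxdot Q=\{m\mid\mathrm{supp}(m)\subseteq Q\}$. $\vDash\langle\varphi\rangle C\langle\psi\rangle$ iff $\llbracket C\rrbracket^\dagger(m)\in\psi$ for every $m\in\varphi$. The weakest precondition is $[C]^\star Q=\{\sigma\in\Sigma\mid\llbracket C\rrbracket(\sigma)\subseteq Q\}$. The total-correctness triple $[P]C[Q]$ is valid iff for every $\sigma\in P$, $C$ cannot diverge from $\sigma$ ($\natural\notin\llbracket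 C\rrbracket(\sigma)$) and all outcomes lie in $Q$. *)

theory Defs
  imports Main
begin

text \<open>Program states extended with nontermination; \<open>'s\<close> plays the role of \<open>\<Sigma>\<close>, so that
  \<open>P \<subseteq> \<Sigma>\<close> becomes \<open>State ` P\<close> inside \<open>\<Sigma>\<close> extended by \<open>Diverge\<close>.\<close>

datatype 's outcome = State 's | Diverge

text \<open>Over the Boolean semiring a weighting function is identified with its support.
  Mass is a semiring element, hence of type \<^typ>\<open>bool\<close>: it is \<^const>\<open>True\<close> (that is, 1)
  iff the support is nonempty.\<close>

type_synonym 's weighting = "'s outcome set"

type_synonym 's denotation = "'s \<Rightarrow> 's weighting"

definition mass :: "'s weighting \<Rightarrow> bool"
  where "mass m \<longleftrightarrow> m \<noteq> {}"

definition lift :: "'s denotation \<Rightarrow> 's weighting \<Rightarrow> 's weighting"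
  where "lift f S = (\<Union>\<sigma>\<in>{\<sigma>. State \<sigma> \<in> S}. f \<sigma>) \<union> (S \<inter> {Diverge})"

definition precond :: "'s set \<Rightarrow> 's weighting set"
  where "precond P = {m. mass m \<and> m \<subseteq> State ` P}"

definition total_box :: "'s set \<Rightarrow> 's weighting set"
  where "total_box Q = {m. m \<subseteq> State ` Q}"

definition outcome_valid :: "'s weighting set \<Rightarrow> 's denotation \<Rightarrow> 's weighting set \<Rightarrow> bool"
  where "outcome_valid \<phi> f \<psi> \<longleftrightarrow> (\<forall>m\<in>\<phi>. lift f m \<in> \<psi>)"

definition wp :: "'s denotation \<Rightarrow> 's set \<Rightarrow> 's set"
  where "wp f Q = {\<sigma>. f \<sigma> \<subseteq> State ` Q}"

definition total_hoare :: "'s set \<Rightarrow> 's denotation \<Rightarrow> 's set \<Rightarrow> bool"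
  where "total_hoare P f Q \<longleftrightarrow>
    (\<forall>\<sigma>\<in>P. Diverge \<notin> f \<sigma> \<and> (\<forall>\<tau>. State \<tau> \<in> f \<sigma> \<longrightarrow> \<tau> \<in> Q))"

end

theory Submission
  imports Defs
begin

text \<open>\<open>lift f m\<close> is the union of the outcome sets of the states in
  \<open>m\<close>, plus any divergence already in \<open>m\<close>, and \<open>total_box Q\<close>
  is closed under unions. So the triple is decided by the singletons of states in \<open>P\<close>,
  where it is membership in \<open>wp f Q\<close> (\<open>outcome_valid_total_box_iff\<close>).
  Pointwise, that membership is total correctness (\<open>subset_State_image_iff\<close>).\<close>

lemma lift_singleton: "lift f {State \<sigma>} = f \<sigma>"
  by (auto simp: lift_def)

lemma singleton_in_precond: "{State \<sigma>} \<in> precond P \<longleftrightarrow> \<sigma> \<in> P"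
  by (auto simp: precond_def mass_def)

lemma outcome_valid_total_box_iff:
  "outcome_valid (precond P) f (total_box Q) \<longleftrightarrow> P \<subseteq> wp f Q"
proof
  assume valid: "outcome_valid (precond P) f (total_box Q)"
  show "P \<subseteq> wp f Q"
  proof
    fix \<sigma> assume "\<sigma> \<in> P"
    \<comment> \<open>Testing the triple on the point mass at \<open>\<sigma>\<close> isolates
      \<open>f \<sigma>\<close>.\<close>
    then have "lift f {State \<sigma>} \<in> total_box Q"
      using valid by (simp add: outcome_valid_def singleton_in_precond)
    then show "\<sigma> \<in> wp f Q"
      by (simp add: lift_singleton total_box_def wp_def)
  qed
next
  assume sub: "P \<subseteq> wp f Q"
  have "lift f m \<subseteq> State ` Q" if m: "m \<subseteq> State ` P" for m
  proof -
    \<comment> \<open>Only proper states occur in \<open>m\<close>, so \<open>lift\<close> passes on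
      no divergence from the input.\<close>
    have "m \<inter> {Diverge} = {}"
      using m by blast
    moreover have "f \<sigma> \<subseteq> State ` Q" if "State \<sigma> \<in> m" for \<sigma>
      using that m sub unfolding wp_def by blast
    ultimately show ?thesis
      unfolding lift_def by blast
  qed
  then show "outcome_valid (precond P) f (total_box Q)"
    by (simp add: outcome_valid_def precond_def total_box_def)
qed

text \<open>The image of \<open>State\<close> omits \<open>Diverge\<close>, so one inclusion packs
  termination and correctness of the final states together.\<close>

lemma subset_State_image_iff:
  "A \<subseteq> State ` Q \<longleftrightarrow> Diverge \<notin> A \<and> (\<forall>\<tau>. State \<tau> \<in> A \<longrightarrow> \<tau> \<in> Q)"
proof
  assume "A \<subseteq> State ` Q"
  then show "Diverge \<notin> A \<and> (\<forall>\<tau>. State \<tau> \<in> A \<longrightarrow> \<tau> \<in> Q)"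
    by blast
next
  assume total: "Diverge \<notin> A \<and> (\<forall>\<tau>. State \<tau> \<in> A \<longrightarrow> \<tau> \<in> Q)"
  show "A \<subseteq> State ` Q"
  proof
    fix x assume "x \<in> A"
    with total show "x \<in> State ` Q"
      by (cases x) simp_all
  qed
qed

lemma subset_wp_iff_total_hoare: "P \<subseteq> wp f Q \<longleftrightarrow> total_hoare P f Q"
  unfolding wp_def total_hoare_def subset_State_image_iff by blast

theorem mainTheorem5:
  fixes sem :: "'c \<Rightarrow> 's denotation"
    and C :: 'c
    and P Q :: "'s set"
  shows "(outcome_valid (precond P) (sem C) (total_box Q) \<longleftrightarrow> P \<subseteq> wp (sem C) Q) \<and>
         (P \<subseteq> wp (sem C) Q \<longleftrightarrow> total_hoare P (sem C) Q)"
  by (intro conjI outcome_valid_total_box_iff subset_wp_iff_total_hoare)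

end
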